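(* Every class of equivalent elements in $P_2$ (i.e. every set $C\subseteq X^*$ of all words representing a given element of $P_2$) corresponds, under the bijection $\pi:X^*\to S^*$, to an interval in the weak Bruhat order on $*$-permutations. Moreover, the top of this interval always corresponds to a $132$-avoiding $*$-permutation and the bottom to a $231$-avoiding $*$-permutation.
   Context: $X=\{x_0,x_1,x_2,\dots\}$, $X^*$ is the free monoid on $X$, and $P_2$ is Thompson's monoid, with monoid presentation $P_2=\mathrm{Mon}\langle x_0,x_1,x_2,\dots\mid x_ix_j=x_{j+1}x_i \text{ for } i<j\rangle$. $*$-permutations. A $*$-permutation of length $n$ is a map $\sigma:\mathbb N^+\to\{1,\dots,n\}\cup\{*\}$, $\mathbb N^+=\{1,2,\dots\}$, such that each of $1,\dots,n$ has exactly one preimage; it is viewed as an infinite sequence of terms. The symbols $1,\dots,n$ are called concrete, and $*$ is considered larger than every concrete symbol. $S^*$ is the set of all $*$-permutations (of all lengths). The bijections $x$ and $\pi$. For $\sigma\in S^*$ of length $n$ and $1\le i\le n$, $\mathsf{inv}_i(\sigma)=\#\{j\mid 1\le j<\sigma^{-1}(i),\ \sigma(j)>i\}$ (terms equal to $*$ are counted), and $x(\sigma)=x_{\mathsf{inv}_1(\sigma)}x_{\mathsf{inv}_2(\sigma)}\cdots x_{\mathsf{inv}_n(\sigma)}\in X^*$. The map $x:S^*\to X^*$ is a bijection, and $\pi:X^*\to S^*$ is its inverse. Weak Bruhat order. For a fixed set of $n$ positions in $\mathbb N^+$, let $S_n'$ be the set of $*$-permutations of length $n$ whose concrete symbols occupy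 exactly these positions. For $\sigma\in S_n'$, $(i\ i+1)\circ\sigma$ is obtained from $\sigma$ by exchanging the positions of $i$ and $i+1$. The (left) weak Bruhat order $\preceq$ on $S_n'$ is the reflexive transitive closure of the relations "$(i\ i+1)\circ\sigma$ covers $\sigma$ whenever $i$ is to the left of $i+1$ in $\sigma$". The weak Bruhat order on $*$-permutations is the one given on each such set $S_n'$ (an interval lies in a single $S_n'$). Pattern avoidance. Let $z$ be the position of the last concrete symbol of $\sigma$. $\sigma$ is $132$-avoiding if there are no indices $1\le a<b<c\le z$ with $\sigma(a)<\sigma(c)<\sigma(b)$, and $231$-avoiding if there are no indices $1\le a<b<c\le z$ with $\sigma(c)<\sigma(a)<\sigma(b)$ (in both cases $\sigma(b)$ may be $*$, while the other two symbols must be concrete). *)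

theory Defs
  imports
    "HOL-Algebra.Group"
    "HOL-Library.Extended_Nat"
    "HOL-Library.FuncSet"
    "HOL-Combinatorics.Transposition"
begin

section \<open>Monoid presentations and Thompson's monoid\<close>

inductive pres_equiv :: "('a list \<times> 'a list) set \<Rightarrow> 'a list \<Rightarrow> 'a list \<Rightarrow> bool"
  for R :: "('a list \<times> 'a list) set" where
  rel: "(u, v) \<in> R \<Longrightarrow> pres_equiv R u v"
| refl: "pres_equiv R u u"
| sym: "pres_equiv R u v \<Longrightarrow> pres_equiv R v u"
| trans: "pres_equiv R u v \<Longrightarrow> pres_equiv R v w \<Longrightarrow> pres_equiv R u w"
| append: "pres_equiv R u v \<Longrightarrow> pres_equiv R u' v' \<Longrightarrow> pres_equiv R (u @ u') (v @ v')"

definition pres_congruence :: "('a list \<times> 'a list) set \<Rightarrow> ('a list \<times> 'a list) set" where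
  "pres_congruence R = {(u, v). pres_equiv R u v}"

definition word_value :: "('a list \<times> 'a list) set \<Rightarrow> 'a list \<Rightarrow> 'a list set" where
  "word_value R w = pres_congruence R `` {w}"

definition presented_monoid :: "('a list \<times> 'a list) set \<Rightarrow> 'a list set monoid" where
  "presented_monoid R =
     \<lparr>carrier = UNIV // pres_congruence R,
      mult = (\<lambda>g h. \<Union>u\<in>g. \<Union>v\<in>h. word_value R (u @ v)),
      one = word_value R []\<rparr>"

lemma equiv_pres_congruence: "equiv UNIV (pres_congruence R)"
proof (rule equivI)
  show "refl (pres_congruence R)"
    by (simp add: pres_congruence_def refl_on_def pres_equiv.refl)
  show "sym (pres_congruence R)"
    unfolding sym_def pres_congruence_def using pres_equiv.sym[of R] by blast
  show "trans (pres_congruence R)"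
    unfolding trans_def pres_congruence_def using pres_equiv.trans[of R] by blast
qed simp

lemma word_value_eq_iff: "word_value R u = word_value R v \<longleftrightarrow> pres_equiv R u v"
  using eq_equiv_class_iff[OF equiv_pres_congruence, of u v R]
  by (simp add: word_value_def pres_congruence_def)

lemma carrier_presented_monoid: "carrier (presented_monoid R) = range (word_value R)"
  by (auto simp: presented_monoid_def word_value_def quotient_def)

lemma one_presented_monoid: "\<one>\<^bsub>presented_monoid R\<^esub> = word_value R []"
  by (simp add: presented_monoid_def)

lemma mult_presented_monoid:
  "word_value R u \<otimes>\<^bsub>presented_monoid R\<^esub> word_value R v = word_value R (u @ v)"
proof -
  have "word_value R (u' @ v') = word_value R (u @ v)"
    if "u' \<in> word_value R u" "v' \<in> word_value R v" for u' v'
  proof -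
    have "pres_equiv R u u'" "pres_equiv R v v'"
      using that by (simp_all add: word_value_def pres_congruence_def)
    then show ?thesis
      unfolding word_value_eq_iff by (rule pres_equiv.sym[OF pres_equiv.append])
  qed
  moreover have "u \<in> word_value R u" "v \<in> word_value R v"
    by (simp_all add: word_value_def pres_congruence_def pres_equiv.refl)
  ultimately have "(\<Union>u'\<in>word_value R u. \<Union>v'\<in>word_value R v. word_value R (u' @ v'))
      = (\<Union>u'\<in>word_value R u. \<Union>v'\<in>word_value R v. word_value R (u @ v))"
    by (intro SUP_cong HOL.refl)
  also have "\<dots> = word_value R (u @ v)"
    using \<open>u \<in> word_value R u\<close> \<open>v \<in> word_value R v\<close> by auto
  finally show ?thesis
    by (simp add: presented_monoid_def)
qed

lemma monoid_presented_monoid: "monoid (presented_monoid R)"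
  by (rule monoidI)
    (auto simp: carrier_presented_monoid mult_presented_monoid one_presented_monoid)

text \<open>The generator \<open>x\<^sub>i\<close> is encoded by its index \<open>i\<close>, so words over \<open>X\<close> have type \<^typ>\<open>nat list\<close>.\<close>

definition thompson_rels :: "(nat list \<times> nat list) set" where
  "thompson_rels = {([i, j], [j + 1, i]) | i j. i < j}"

definition P2 :: "nat list set monoid" where
  "P2 = presented_monoid thompson_rels"


section \<open>Star-permutations\<close>

text \<open>
  The concrete symbol \<open>i\<close> is \<^term>\<open>enat i\<close> and the star is \<^term>\<open>\<infinity> :: enat\<close>; the order of
  \<^typ>\<open>enat\<close> then makes the star larger than every concrete symbol. Maps on positive
  positions are extensional functions on \<^term>\<open>{1::nat..}\<close>: the value at \<open>0\<close> is the fixed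
  junk value \<^term>\<open>undefined\<close>, so that equality of functions is equality of sequences.
\<close>

definition star_perms_of_length :: "nat \<Rightarrow> (nat \<Rightarrow> enat) set" where
  "star_perms_of_length n =
     {\<sigma> \<in> {1..} \<rightarrow>\<^sub>E (enat ` {1..n} \<union> {\<infinity>}). \<forall>i\<in>{1..n}. \<exists>!p. p \<in> {1..} \<and> \<sigma> p = enat i}"

definition star_perms :: "(nat \<Rightarrow> enat) set" where
  "star_perms = (\<Union>n. star_perms_of_length n)"

definition perm_length :: "(nat \<Rightarrow> enat) \<Rightarrow> nat" where
  "perm_length \<sigma> = (THE n. \<sigma> \<in> star_perms_of_length n)"

definition position :: "(nat \<Rightarrow> enat) \<Rightarrow> nat \<Rightarrow> nat" where
  "position \<sigma> i = (THE p. p \<in> {1..} \<and> \<sigma> p = enat i)"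

definition concrete_positions :: "(nat \<Rightarrow> enat) \<Rightarrow> nat set" where
  "concrete_positions \<sigma> = {p \<in> {1..}. \<sigma> p \<noteq> \<infinity>}"

definition inv_count :: "(nat \<Rightarrow> enat) \<Rightarrow> nat \<Rightarrow> nat" where
  "inv_count \<sigma> i = card {j. 1 \<le> j \<and> j < position \<sigma> i \<and> \<sigma> j > enat i}"

definition word_of_perm :: "(nat \<Rightarrow> enat) \<Rightarrow> nat list" where
  "word_of_perm \<sigma> = map (inv_count \<sigma>) [1..<perm_length \<sigma> + 1]"

text \<open>\<^const>\<open>word_of_perm\<close> is a bijection from \<^const>\<open>star_perms\<close> onto all words; this is its inverse.\<close>

definition perm_of_word :: "nat list \<Rightarrow> (nat \<Rightarrow> enat)" where
  "perm_of_word = the_inv_into star_perms word_of_perm"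


section \<open>Weak Bruhat order\<close>

definition perms_at :: "nat set \<Rightarrow> (nat \<Rightarrow> enat) set" where
  "perms_at A = {\<sigma> \<in> star_perms_of_length (card A). concrete_positions \<sigma> = A}"

text \<open>
  \<^term>\<open>compose {1..} f \<sigma>\<close> is \<open>f \<circ> \<sigma>\<close> on positive positions and \<^term>\<open>undefined\<close> at \<open>0\<close>.
\<close>

definition weak_cover :: "nat set \<Rightarrow> (nat \<Rightarrow> enat) \<Rightarrow> (nat \<Rightarrow> enat) \<Rightarrow> bool" where
  "weak_cover A \<sigma> \<tau> \<longleftrightarrow> \<sigma> \<in> perms_at A \<and>
     (\<exists>i. 1 \<le> i \<and> i < card A \<and> position \<sigma> i < position \<sigma> (i + 1) \<and>
          \<tau> = compose {1..} (Transposition.transpose (enat i) (enat (i + 1))) \<sigma>)"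

definition weak_le :: "nat set \<Rightarrow> (nat \<Rightarrow> enat) \<Rightarrow> (nat \<Rightarrow> enat) \<Rightarrow> bool" where
  "weak_le A \<sigma> \<tau> \<longleftrightarrow> \<sigma> \<in> perms_at A \<and> \<tau> \<in> perms_at A \<and> (weak_cover A)\<^sup>*\<^sup>* \<sigma> \<tau>"

definition weak_interval ::
    "nat set \<Rightarrow> (nat \<Rightarrow> enat) \<Rightarrow> (nat \<Rightarrow> enat) \<Rightarrow> (nat \<Rightarrow> enat) set" where
  "weak_interval A \<beta> \<tau> = {\<rho> \<in> perms_at A. weak_le A \<beta> \<rho> \<and> weak_le A \<rho> \<tau>}"


section \<open>Pattern avoidance\<close>

text \<open>
  In length \<open>0\<close> there is no last concrete position and \<^term>\<open>Max {}\<close> is unspecified; this is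
  harmless, as both patterns below require concrete symbols.
\<close>

definition last_concrete :: "(nat \<Rightarrow> enat) \<Rightarrow> nat" where
  "last_concrete \<sigma> = Max (concrete_positions \<sigma>)"

definition avoids_132 :: "(nat \<Rightarrow> enat) \<Rightarrow> bool" where
  "avoids_132 \<sigma> \<longleftrightarrow>
     \<not> (\<exists>a b c. 1 \<le> a \<and> a < b \<and> b < c \<and> c \<le> last_concrete \<sigma> \<and> \<sigma> a < \<sigma> c \<and> \<sigma> c < \<sigma> b)"

definition avoids_231 :: "(nat \<Rightarrow> enat) \<Rightarrow> bool" where
  "avoids_231 \<sigma> \<longleftrightarrow>
     \<not> (\<exists>a b c. 1 \<le> a \<and> a < b \<and> b < c \<and> c \<le> last_concrete \<sigma> \<and> \<sigma> c < \<sigma> a \<and> \<sigma> a < \<sigma> b)"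

end

theory Submission
  imports Defs "HOL-Library.Infinite_Set"
begin

text \<open>
  Under the bijection with star-permutations, the defining relation of Thompson's monoid exchanges
  the consecutive symbols \<open>i\<close> and \<open>i + 1\<close> of a star-permutation, and it does so exactly when a
  symbol larger than both, possibly a star, stands between them
  (\<open>word_of_perm_exchange\<close>). Such exchanges are covers in the weak order; they are called
  separated covers below. In terms of the list of positions of \<open>1, 2, \<dots>\<close> this is the
  sylvester congruence, with the positions of the stars put at the end of the list. As there, each
  class is the set of linear extensions of a forest.

  The forest order is \<open>dominates\<close>: the position \<open>q\<close> dominates \<open>p\<close> if \<open>q\<close> carries a concrete symbol
  larger than all other symbols from \<open>p\<close> to \<open>q\<close>. A separated cover does not change this relation
  (\<open>dominates_separated_cover\<close>): it only affects the comparison of two positions neither of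
  which dominates anything beyond the larger symbol between them.
  Conversely the relation determines the class. From any star-permutation, go down along
  separated covers until none is left. If a \<open>231\<close> pattern remained, one with
  consecutive symbols in the two outer positions would remain too, and that one allows a further
  step down (\<open>pattern_231_separated\<close>). So the star-permutation that is reached avoids \<open>231\<close>; avoidance
  means that its inversions are exactly the pairs in which the left position dominates
  the right one (\<open>minimal_inversion_iff\<close>), hence the domination relation determines it. Going up leads in
  the same way to a unique \<open>132\<close>-avoiding star-permutation whose noninversions are the pairs in which
  the right position dominates the left one.

  Therefore every member of a class lies above one common bottom and below one common top. Any
  star-permutation between the two has all inversions of the bottom and all
  noninversions of the top, so its domination relation contains that of the class; a domination
  relation cannot be strictly contained in another one on the same positions
  (\<open>dominates_eqI\<close>), so it belongs to the class.
\<close>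


section \<open>Star-permutations as bijections from a finite set of positions\<close>

lemma concrete_position_iff: "p \<in> concrete_positions \<sigma> \<longleftrightarrow> 1 \<le> p \<and> \<sigma> p \<noteq> \<infinity>"
  by (auto simp: concrete_positions_def)

lemma star_perms_of_length_iff:
  "\<sigma> \<in> star_perms_of_length n \<longleftrightarrow>
     \<sigma> \<in> extensional {1..} \<and> bij_betw \<sigma> (concrete_positions \<sigma>) (enat ` {1..n})"
proof (intro iffI conjI)
  assume L: "\<sigma> \<in> star_perms_of_length n"
  then have val: "\<sigma> p \<in> enat ` {1..n} \<union> {\<infinity>}" if "1 \<le> p" for p
    using that by (auto simp: star_perms_of_length_def PiE_def Pi_def)
  have ex1: "\<exists>!p. p \<in> {1..} \<and> \<sigma> p = enat i" if "i \<in> {1..n}" for i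
    using L that by (auto simp: star_perms_of_length_def)
  show "\<sigma> \<in> extensional {1..}"
    using L by (auto simp: star_perms_of_length_def PiE_def)
  show "bij_betw \<sigma> (concrete_positions \<sigma>) (enat ` {1..n})"
  proof (rule bij_betwI')
    fix p q assume p: "p \<in> concrete_positions \<sigma>" and q: "q \<in> concrete_positions \<sigma>"
    obtain i where i: "i \<in> {1..n}" "\<sigma> p = enat i"
      using val[of p] p by (auto simp: concrete_position_iff)
    show "(\<sigma> p = \<sigma> q) = (p = q)"
      using ex1[OF i(1)] i p q by (auto simp: concrete_position_iff)
  next
    fix p assume "p \<in> concrete_positions \<sigma>"
    then show "\<sigma> p \<in> enat ` {1..n}"
      using val[of p] by (auto simp: concrete_position_iff)
  next
    fix y assume "y \<in> enat ` {1..n}"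
    then obtain i where i: "i \<in> {1..n}" "y = enat i" by blast
    then obtain p where "1 \<le> p" "\<sigma> p = enat i"
      using ex1[OF i(1)] by auto
    then show "\<exists>p\<in>concrete_positions \<sigma>. y = \<sigma> p"
      using i(2) by (intro bexI[of _ p]) (auto simp: concrete_position_iff)
  qed
next
  assume R: "\<sigma> \<in> extensional {1..} \<and> bij_betw \<sigma> (concrete_positions \<sigma>) (enat ` {1..n})"
  then have inj: "inj_on \<sigma> (concrete_positions \<sigma>)"
    and im: "\<sigma> ` concrete_positions \<sigma> = enat ` {1..n}"
    by (auto simp: bij_betw_def)
  have "\<sigma> p \<in> enat ` {1..n} \<union> {\<infinity>}" if "1 \<le> p" for p
    using that im imageI[of p "concrete_positions \<sigma>" \<sigma>] concrete_position_iff[of p \<sigma>]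
    by (metis UnI1 UnI2 singletonI)
  moreover have "\<exists>!p. p \<in> {1..} \<and> \<sigma> p = enat i" if "i \<in> {1..n}" for i
  proof -
    have "enat i \<in> \<sigma> ` concrete_positions \<sigma>"
      unfolding im using that by (rule imageI)
    then obtain p where p: "p \<in> concrete_positions \<sigma>" "\<sigma> p = enat i"
      by (metis imageE)
    show ?thesis
    proof (rule ex1I[of _ p])
      show "p \<in> {1..} \<and> \<sigma> p = enat i" using p by (simp add: concrete_position_iff)
      fix q assume "q \<in> {1..} \<and> \<sigma> q = enat i"
      then show "q = p"
        using inj_onD[OF inj, of q p] p by (simp add: concrete_position_iff)
    qed
  qed
  ultimately show "\<sigma> \<in> star_perms_of_length n"
    using R unfolding star_perms_of_length_def PiE_def Pi_def by blast
qed

lemma perms_at_iff: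
  "\<sigma> \<in> perms_at A \<longleftrightarrow>
     \<sigma> \<in> extensional {1..} \<and> concrete_positions \<sigma> = A \<and> bij_betw \<sigma> A (enat ` {1..card A})"
  by (auto simp: perms_at_def star_perms_of_length_iff)

lemma perms_at_finite: "\<sigma> \<in> perms_at A \<Longrightarrow> finite A"
  using bij_betw_finite by (fastforce simp: perms_at_iff)

lemma perms_at_concrete: "\<sigma> \<in> perms_at A \<Longrightarrow> p \<in> A \<longleftrightarrow> 1 \<le> p \<and> \<sigma> p \<noteq> \<infinity>"
  by (auto simp: perms_at_iff concrete_position_iff)

lemma perms_at_inj: "\<sigma> \<in> perms_at A \<Longrightarrow> p \<in> A \<Longrightarrow> q \<in> A \<Longrightarrow> \<sigma> p = \<sigma> q \<longleftrightarrow> p = q"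
  by (auto simp: perms_at_iff bij_betw_def inj_on_def)

lemma perms_at_value:
  assumes "\<sigma> \<in> perms_at A" "p \<in> A"
  shows "\<exists>i. \<sigma> p = enat i \<and> 1 \<le> i \<and> i \<le> card A"
proof -
  have "\<sigma> p \<in> enat ` {1..card A}"
    using assms bij_betwE unfolding perms_at_iff by blast
  then show ?thesis by auto
qed

lemma perms_at_symbol:
  assumes "\<sigma> \<in> perms_at A" "1 \<le> i" "i \<le> card A"
  shows "\<exists>p. p \<in> A \<and> \<sigma> p = enat i"
proof -
  have "enat i \<in> \<sigma> ` A"
    using assms by (auto simp: perms_at_iff bij_betw_def)
  then show ?thesis by auto
qed

lemma star_perms_of_length_imp_perms_at:
  assumes "\<sigma> \<in> star_perms_of_length n"
  shows "\<sigma> \<in> perms_at (concrete_positions \<sigma>)" "card (concrete_positions \<sigma>) = n"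
proof -
  show c: "card (concrete_positions \<sigma>) = n"
    using assms bij_betw_same_card[of \<sigma> "concrete_positions \<sigma>" "enat ` {1..n}"]
    by (simp add: star_perms_of_length_iff card_image inj_on_def)
  show "\<sigma> \<in> perms_at (concrete_positions \<sigma>)"
    using assms c by (simp add: perms_at_def)
qed

lemma perms_at_imp_star_perms: "\<sigma> \<in> perms_at A \<Longrightarrow> \<sigma> \<in> star_perms"
  by (auto simp: perms_at_def star_perms_def)

lemma star_perms_imp_perms_at: "\<sigma> \<in> star_perms \<Longrightarrow> \<sigma> \<in> perms_at (concrete_positions \<sigma>)"
  by (auto simp: star_perms_def dest: star_perms_of_length_imp_perms_at)

lemma perm_length_perms_at:
  assumes "\<sigma> \<in> perms_at A"
  shows "perm_length \<sigma> = card A"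
  unfolding perm_length_def
proof (rule the_equality)
  show "\<sigma> \<in> star_perms_of_length (card A)"
    using assms by (simp add: perms_at_def)
  show "n = card A" if "\<sigma> \<in> star_perms_of_length n" for n
    using star_perms_of_length_imp_perms_at(2)[OF that] assms by (simp add: perms_at_def)
qed

lemma position_eq:
  assumes "\<sigma> \<in> perms_at A" "1 \<le> p" "\<sigma> p = enat i"
  shows "position \<sigma> i = p"
  unfolding position_def
proof (rule the_equality)
  show "p \<in> {1..} \<and> \<sigma> p = enat i" using assms by simp
  show "q = p" if "q \<in> {1..} \<and> \<sigma> q = enat i" for q
    using that assms perms_at_inj[OF assms(1), of q p] by (simp add: perms_at_concrete[OF assms(1)])
qed

lemma perms_at_symbol_range:
  assumes "\<sigma> \<in> perms_at A" "1 \<le> p" "\<sigma> p = enat i"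
  shows "p \<in> A" "1 \<le> i" "i \<le> card A"
proof -
  show "p \<in> A" using assms by (simp add: perms_at_concrete[OF assms(1)])
  then show "1 \<le> i" "i \<le> card A"
    using perms_at_value[OF assms(1), of p] assms(3) by auto
qed

lemma perms_at_eqI:
  assumes \<sigma>: "\<sigma> \<in> perms_at A" and \<tau>: "\<tau> \<in> perms_at A"
    and eq: "\<And>p. p \<in> A \<Longrightarrow> \<sigma> p = \<tau> p"
  shows "\<sigma> = \<tau>"
proof
  fix p
  show "\<sigma> p = \<tau> p"
  proof (cases "p \<in> A")
    case False
    show ?thesis
    proof (cases "1 \<le> p")
      case True
      then show ?thesis
        using False perms_at_concrete[OF \<sigma>, of p] perms_at_concrete[OF \<tau>, of p] by simp
    next
      case False
      then have "p \<notin> {1..}" by simp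
      then show ?thesis
        using extensional_arb[of \<sigma> "{1..}" p] extensional_arb[of \<tau> "{1..}" p] \<sigma> \<tau>
        unfolding perms_at_iff by argo
    qed
  qed (rule eq)
qed

text \<open>
  A symbol is the rank of its position in the order in which the concrete positions are
  listed, so the relative order of the symbols determines the star-permutation.
\<close>

lemma perms_at_eq_if_same_order:
  assumes \<sigma>: "\<sigma> \<in> perms_at A" and \<tau>: "\<tau> \<in> perms_at A"
    and order: "\<And>p q. p \<in> A \<Longrightarrow> q \<in> A \<Longrightarrow> p < q \<Longrightarrow> \<sigma> p < \<sigma> q \<longleftrightarrow> \<tau> p < \<tau> q"
  shows "\<sigma> = \<tau>"
proof -
  have rank: "\<rho> p = enat (card {q \<in> A. \<rho> q \<le> \<rho> p})" if \<rho>: "\<rho> \<in> perms_at A" and p: "p \<in> A" for \<rho> p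
  proof -
    obtain i where i: "\<rho> p = enat i" "1 \<le> i" "i \<le> card A"
      using perms_at_value[OF \<rho> p] by blast
    have inj: "inj_on \<rho> A" and im: "\<rho> ` A = enat ` {1..card A}"
      using \<rho> by (auto simp: perms_at_iff bij_betw_def)
    have "\<rho> ` {q \<in> A. \<rho> q \<le> \<rho> p} = {y \<in> \<rho> ` A. y \<le> \<rho> p}"
      by auto
    also have "\<dots> = enat ` {1..i}"
      unfolding im using i by auto
    finally have "card (\<rho> ` {q \<in> A. \<rho> q \<le> \<rho> p}) = i"
      by (simp add: card_image inj_on_def)
    moreover have "card (\<rho> ` {q \<in> A. \<rho> q \<le> \<rho> p}) = card {q \<in> A. \<rho> q \<le> \<rho> p}"
      by (rule card_image) (rule inj_on_subset[OF inj], auto)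
    ultimately show ?thesis using i by simp
  qed
  have "\<sigma> q \<le> \<sigma> p \<longleftrightarrow> \<tau> q \<le> \<tau> p" if "p \<in> A" "q \<in> A" for p q
    using order[of p q] order[of q p] that perms_at_inj[OF \<sigma> that] perms_at_inj[OF \<tau> that]
    by (metis linorder_neqE_nat not_le order_le_less order_less_imp_le)
  then have "{q \<in> A. \<sigma> q \<le> \<sigma> p} = {q \<in> A. \<tau> q \<le> \<tau> p}" if "p \<in> A" for p
    using that by blast
  then show ?thesis
    using rank[OF \<sigma>] rank[OF \<tau>] by (intro perms_at_eqI[OF \<sigma> \<tau>]) simp
qed


section \<open>The bijection between star-permutations and words\<close>

lemma inv_count_eq:
  assumes "\<sigma> \<in> perms_at A" "1 \<le> p" "\<sigma> p = enat i"
  shows "inv_count \<sigma> i = card {j \<in> {1..<p}. enat i < \<sigma> j}"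
  unfolding inv_count_def position_eq[OF assms] by (rule arg_cong[where f = card]) auto

lemma length_word_of_perm: "\<sigma> \<in> perms_at A \<Longrightarrow> length (word_of_perm \<sigma>) = card A"
  by (simp add: word_of_perm_def perm_length_perms_at)

lemma nth_word_of_perm:
  "\<sigma> \<in> perms_at A \<Longrightarrow> k < card A \<Longrightarrow> word_of_perm \<sigma> ! k = inv_count \<sigma> (Suc k)"
  by (simp add: word_of_perm_def perm_length_perms_at del: upt_Suc)

text \<open>
  The count of the symbol \<open>i\<close> is the rank of its position among the positions that the
  symbols below \<open>i\<close> leave free. Reading a word from the left therefore
  recovers the position of each symbol in turn.
\<close>

lemma word_of_perm_inject:
  assumes \<sigma>: "\<sigma> \<in> perms_at A" and \<tau>: "\<tau> \<in> perms_at B"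
    and w: "word_of_perm \<sigma> = word_of_perm \<tau>"
  shows "\<sigma> = \<tau>"
proof -
  have card: "card A = card B"
    using length_word_of_perm[OF \<sigma>] length_word_of_perm[OF \<tau>] w by simp
  have pos: "\<tau> p = enat i" if "1 \<le> p" "\<sigma> p = enat i" for p i
    using that
  proof (induction i arbitrary: p rule: less_induct)
    case (less i)
    have i: "1 \<le> i" "i \<le> card A"
      using perms_at_symbol_range[OF \<sigma> less.prems] by auto
    obtain q where q: "q \<in> B" "\<tau> q = enat i"
      using perms_at_symbol[OF \<tau> i(1)] i(2) card by auto
    have q1: "1 \<le> q" using q perms_at_concrete[OF \<tau>] by blast
    have lower: "\<sigma> j < enat i \<longleftrightarrow> \<tau> j < enat i" if "1 \<le> j" for j
    proof
      assume lt: "\<sigma> j < enat i"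
      then obtain k where "\<sigma> j = enat k" "k < i" by (cases "\<sigma> j") auto
      then show "\<tau> j < enat i" using less.IH[of k j] that by simp
    next
      assume "\<tau> j < enat i"
      then obtain k where k: "\<tau> j = enat k" "k < i" by (cases "\<tau> j") auto
      have k1: "1 \<le> k" "k \<le> card A"
        using perms_at_symbol_range[OF \<tau> that k(1)] card by auto
      obtain j' where j': "j' \<in> A" "\<sigma> j' = enat k"
        using perms_at_symbol[OF \<sigma> k1] by blast
      have "1 \<le> j'" using j' perms_at_concrete[OF \<sigma>] by blast
      then have "\<tau> j' = enat k" using less.IH[of k j'] j' k by simp
      then have "j = j'"
        using position_eq[OF \<tau> that k(1)] position_eq[OF \<tau> \<open>1 \<le> j'\<close>] by simp
      then show "\<sigma> j < enat i" using j' k by simp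
    qed
    \<comment> \<open>the positions left free by the symbols below \<open>i\<close>, which are the same in \<open>\<sigma>\<close> and \<open>\<tau>\<close>\<close>
    define F where "F = {j. 1 \<le> j \<and> enat i \<le> \<sigma> j}"
    have F\<tau>: "F = {j. 1 \<le> j \<and> enat i \<le> \<tau> j}"
      unfolding F_def using lower by (auto simp: not_less[symmetric])
    have c: "inv_count \<rho> i = card {j \<in> F. j < r}"
      if "\<rho> \<in> perms_at D" "1 \<le> r" "\<rho> r = enat i" "F = {j. 1 \<le> j \<and> enat i \<le> \<rho> j}" for \<rho> D r
    proof -
      have "enat i < \<rho> j \<longleftrightarrow> enat i \<le> \<rho> j" if "1 \<le> j" "j < r" for j
        using position_eq[OF \<open>\<rho> \<in> perms_at D\<close> that(1), of i] that
          position_eq[OF \<open>\<rho> \<in> perms_at D\<close> \<open>1 \<le> r\<close> \<open>\<rho> r = enat i\<close>]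
        by (auto simp: order_le_less)
      then show ?thesis
        unfolding inv_count_eq[OF that(1-3)] that(4) by (intro arg_cong[where f = card]) auto
    qed
    have "inv_count \<sigma> i = inv_count \<tau> i"
      using nth_word_of_perm[OF \<sigma>, of "i - 1"] nth_word_of_perm[OF \<tau>, of "i - 1"] w i card by simp
    then have eq: "card {j \<in> F. j < p} = card {j \<in> F. j < q}"
      using c[OF \<sigma> less.prems F_def] c[OF \<tau> q1 q(2) F\<tau>] by simp
    have "p \<in> F" unfolding F_def using less.prems by simp
    have "q \<in> F" unfolding F\<tau> using q q1 by simp
    have "\<not> r < s" if "r \<in> F" "card {j \<in> F. j < r} = card {j \<in> F. j < s}" for r s
    proof
      assume "r < s"
      then have "{j \<in> F. j < r} \<subset> {j \<in> F. j < s}" using that by auto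
      then have "card {j \<in> F. j < r} < card {j \<in> F. j < s}"
        by (intro psubset_card_mono) simp_all
      then show False using that by simp
    qed
    from this[of p q] this[of q p] have "p = q"
      using eq \<open>p \<in> F\<close> \<open>q \<in> F\<close> by auto
    then show ?case using q by simp
  qed
  have sub: "A \<subseteq> B"
  proof
    fix p assume p: "p \<in> A"
    obtain i where "\<sigma> p = enat i" using perms_at_value[OF \<sigma> p] by blast
    then show "p \<in> B" using pos[of p i] p perms_at_concrete[OF \<sigma>] perms_at_concrete[OF \<tau>] by auto
  qed
  have "A = B"
    by (rule card_subset_eq[OF perms_at_finite[OF \<tau>] sub card])
  then show ?thesis
  proof (intro perms_at_eqI[OF \<sigma>])
    fix p assume p: "p \<in> A"
    obtain i where "\<sigma> p = enat i" using perms_at_value[OF \<sigma> p] by blast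
    then show "\<sigma> p = \<tau> p" using pos[of p i] p perms_at_concrete[OF \<sigma>] by auto
  qed (use \<tau> in simp)
qed

text \<open>
  Appending the letter \<open>x\<^sub>m\<close> to a word replaces the star that has \<open>m\<close> stars to its left by the
  next symbol; the counts of the old symbols do not change, since a star is larger than each of
  them, and so is the new symbol.
\<close>

lemma word_of_perm_surject: "\<exists>A. \<exists>\<sigma>\<in>perms_at A. word_of_perm \<sigma> = w"
proof (induction w rule: rev_induct)
  case Nil
  let ?\<sigma> = "\<lambda>p. if p \<in> {1::nat..} then \<infinity> else undefined :: enat"
  have "?\<sigma> \<in> perms_at {}"
    by (auto simp: perms_at_iff concrete_positions_def extensional_def bij_betw_def)
  moreover have "word_of_perm ?\<sigma> = []"
    using length_word_of_perm[OF \<open>?\<sigma> \<in> perms_at {}\<close>] by simp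
  ultimately show ?case by blast
next
  case (snoc m w)
  then obtain A \<sigma> where \<sigma>: "\<sigma> \<in> perms_at A" and w: "word_of_perm \<sigma> = w" by blast
  define S where "S = {p. 1 \<le> p \<and> \<sigma> p = \<infinity>}"
  have "finite A" by (rule perms_at_finite[OF \<sigma>])
  have "p \<in> S \<longleftrightarrow> p \<notin> insert 0 A" for p
    using perms_at_concrete[OF \<sigma>, of p] by (cases p) (simp_all add: S_def)
  then have "S = - (insert 0 A)" by blast
  then have inf: "infinite S" using \<open>finite A\<close> by (simp add: finite_compl)
  define p where "p = enumerate S m"
  have pS: "p \<in> S" unfolding p_def by (rule enumerate_in_set[OF inf])
  have "{j \<in> S. j < p} = enumerate S ` {..<m}"
  proof (intro equalityI subsetI)
    fix j assume j: "j \<in> {j \<in> S. j < p}"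
    then obtain k where "j = enumerate S k" using enumerate_Ex[OF inf] by blast
    then show "j \<in> enumerate S ` {..<m}" using j inf by (auto simp: p_def)
  next
    fix j assume "j \<in> enumerate S ` {..<m}"
    then show "j \<in> {j \<in> S. j < p}" using inf enumerate_in_set[OF inf] by (auto simp: p_def)
  qed
  then have cS: "card {j \<in> S. j < p} = m"
    using card_image[of "enumerate S" "{..<m}"] inj_enumerate[OF inf]
    by (simp add: inj_on_subset)
  define n where "n = card A"
  define \<tau> where "\<tau> = \<sigma>(p := enat (Suc n))"
  have p1: "1 \<le> p" and \<sigma>p: "\<sigma> p = \<infinity>" and pA: "p \<notin> A"
    using pS perms_at_concrete[OF \<sigma>, of p] by (auto simp: S_def)
  have card': "card (insert p A) = Suc n"
    using pA \<open>finite A\<close> by (simp add: n_def)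
  have bij: "bij_betw \<sigma> A (enat ` {1..n})" using \<sigma> by (simp add: perms_at_iff n_def)
  have "bij_betw \<tau> A (enat ` {1..n})"
    using bij pA by (subst bij_betw_cong[of A \<tau> \<sigma>]) (auto simp: \<tau>_def)
  then have "bij_betw \<tau> (insert p A) (insert (\<tau> p) (enat ` {1..n}))"
    using pA notIn_Un_bij_betw[of p A \<tau> "enat ` {1..n}"] by (simp add: \<tau>_def image_iff)
  also have "insert (\<tau> p) (enat ` {1..n}) = enat ` {1..Suc n}"
    by (auto simp: \<tau>_def atLeastAtMostSuc_conv)
  finally have "bij_betw \<tau> (insert p A) (enat ` {1..card (insert p A)})"
    unfolding card' .
  then have \<tau>: "\<tau> \<in> perms_at (insert p A)"
    using \<sigma> p1 by (auto simp: perms_at_iff \<tau>_def concrete_positions_def extensional_def)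
  have "word_of_perm \<tau> = w @ [m]"
  proof (rule nth_equalityI)
    show "length (word_of_perm \<tau>) = length (w @ [m])"
      using length_word_of_perm[OF \<tau>] length_word_of_perm[OF \<sigma>] card' w by (simp add: n_def)
    fix k assume "k < length (word_of_perm \<tau>)"
    then have k: "k < Suc n" using length_word_of_perm[OF \<tau>] card' by simp
    have lw: "length w = n" using length_word_of_perm[OF \<sigma>] w by (simp add: n_def)
    show "word_of_perm \<tau> ! k = (w @ [m]) ! k"
    proof (cases "k = n")
      case True
      have "{j \<in> {1..<p}. enat (Suc n) < \<tau> j} = {j \<in> S. j < p}"
      proof -
        have "enat (Suc n) < \<sigma> j \<longleftrightarrow> \<sigma> j = \<infinity>" if "1 \<le> j" for j
          using perms_at_symbol_range(3)[OF \<sigma> that] by (cases "\<sigma> j") (auto simp: n_def)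
        then show ?thesis by (auto simp: \<tau>_def S_def)
      qed
      then have "inv_count \<tau> (Suc n) = m"
        using inv_count_eq[OF \<tau> p1, of "Suc n"] cS by (simp add: \<tau>_def)
      then show ?thesis using nth_word_of_perm[OF \<tau>, of k] True card' lw by (simp add: nth_append)
    next
      case False
      then have kn: "k < n" using k by simp
      obtain q where q: "q \<in> A" "\<sigma> q = enat (Suc k)"
        using perms_at_symbol[OF \<sigma>, of "Suc k"] kn by (auto simp: n_def)
      have q1: "1 \<le> q" using q perms_at_concrete[OF \<sigma>] by blast
      have \<tau>q: "\<tau> q = enat (Suc k)" using q pA by (auto simp: \<tau>_def)
      have "{j \<in> {1..<q}. enat (Suc k) < \<tau> j} = {j \<in> {1..<q}. enat (Suc k) < \<sigma> j}"
        using \<sigma>p kn by (auto simp: \<tau>_def)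
      then have "inv_count \<tau> (Suc k) = inv_count \<sigma> (Suc k)"
        using inv_count_eq[OF \<tau> q1 \<tau>q] inv_count_eq[OF \<sigma> q1 q(2)] by simp
      then show ?thesis
        using nth_word_of_perm[OF \<tau>, of k] nth_word_of_perm[OF \<sigma>, of k] kn card' w lw
        by (simp add: n_def nth_append)
    qed
  qed
  then show ?case using \<tau> by blast
qed

lemma inj_on_word_of_perm: "inj_on word_of_perm star_perms"
  using word_of_perm_inject star_perms_imp_perms_at by (blast intro: inj_onI)

lemma perm_of_word_of_perm: "\<sigma> \<in> perms_at A \<Longrightarrow> perm_of_word (word_of_perm \<sigma>) = \<sigma>"
  unfolding perm_of_word_def
  using the_inv_into_f_f[OF inj_on_word_of_perm] perms_at_imp_star_perms by blast

lemma perm_of_word: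
  obtains A where "perm_of_word w \<in> perms_at A" "word_of_perm (perm_of_word w) = w"
  using word_of_perm_surject[of w] perm_of_word_of_perm by metis


section \<open>Exchanging consecutive symbols\<close>

definition exchange :: "nat \<Rightarrow> nat \<Rightarrow> (nat \<Rightarrow> enat) \<Rightarrow> nat \<Rightarrow> enat" where
  "exchange a b \<sigma> = \<sigma>(a := \<sigma> b, b := \<sigma> a)"

lemma exchange_perms_at:
  assumes \<sigma>: "\<sigma> \<in> perms_at A" and a: "a \<in> A" and b: "b \<in> A"
  shows "exchange a b \<sigma> \<in> perms_at A"
proof -
  have eq: "exchange a b \<sigma> = \<sigma> \<circ> Transposition.transpose a b"
    by (auto simp: exchange_def Transposition.transpose_def)
  have "bij_betw (Transposition.transpose a b) A A"
    using a b by (auto simp: bij_betw_def Transposition.transpose_def inj_on_def image_iff)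
  then have "bij_betw (exchange a b \<sigma>) A (enat ` {1..card A})"
    unfolding eq using \<sigma> by (auto intro: bij_betw_trans simp: perms_at_iff)
  then show ?thesis
    using \<sigma> a b perms_at_concrete[OF \<sigma>, of a] perms_at_concrete[OF \<sigma>, of b]
    by (auto simp: perms_at_iff extensional_def concrete_positions_def exchange_def)
qed

lemma exchange_eq_compose:
  assumes \<sigma>: "\<sigma> \<in> perms_at A" and a: "1 \<le> a" "\<sigma> a = enat i" and b: "1 \<le> b" "\<sigma> b = enat j"
  shows "exchange a b \<sigma> = compose {1..} (Transposition.transpose (enat i) (enat j)) \<sigma>"
proof
  fix p
  show "exchange a b \<sigma> p = compose {1..} (Transposition.transpose (enat i) (enat j)) \<sigma> p"
  proof (cases "1 \<le> p")
    case True
    have "\<sigma> p = enat i \<longleftrightarrow> p = a"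
      using position_eq[OF \<sigma> True, of i] position_eq[OF \<sigma> a] a(2) by metis
    moreover have "\<sigma> p = enat j \<longleftrightarrow> p = b"
      using position_eq[OF \<sigma> True, of j] position_eq[OF \<sigma> b] b(2) by metis
    ultimately show ?thesis
      using True a(2) b(2) by (auto simp: exchange_def compose_def Transposition.transpose_def)
  next
    case False
    then have "p \<notin> {1..}" "p \<noteq> a" "p \<noteq> b" using a b by auto
    moreover have "\<sigma> \<in> extensional {1..}" using \<sigma> by (simp add: perms_at_iff)
    ultimately show ?thesis
      using extensional_arb[of \<sigma> "{1..}" p] by (simp add: exchange_def compose_def)
  qed
qed

lemma weak_cover_iff_exchange:
  "weak_cover A \<sigma> \<tau> \<longleftrightarrow> \<sigma> \<in> perms_at A \<and>
     (\<exists>a b i. 1 \<le> a \<and> a < b \<and> \<sigma> a = enat i \<and> \<sigma> b = enat (Suc i) \<and> \<tau> = exchange a b \<sigma>)"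
proof (cases "\<sigma> \<in> perms_at A")
  case \<sigma>: True
  show ?thesis
  proof (intro iffI conjI \<sigma>)
    assume "weak_cover A \<sigma> \<tau>"
    then obtain i where i: "1 \<le> i" "i < card A" "position \<sigma> i < position \<sigma> (i + 1)"
      "\<tau> = compose {1..} (Transposition.transpose (enat i) (enat (i + 1))) \<sigma>"
      by (auto simp: weak_cover_def)
    obtain a where a: "a \<in> A" "\<sigma> a = enat i" using perms_at_symbol[OF \<sigma>, of i] i by auto
    obtain b where b: "b \<in> A" "\<sigma> b = enat (i + 1)" using perms_at_symbol[OF \<sigma>, of "i + 1"] i by auto
    have ab: "1 \<le> a" "1 \<le> b" using a b perms_at_concrete[OF \<sigma>] by blast+
    have "a < b" using i position_eq[OF \<sigma> ab(1) a(2)] position_eq[OF \<sigma> ab(2) b(2)] by simp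
    then show "\<exists>a b i. 1 \<le> a \<and> a < b \<and> \<sigma> a = enat i \<and> \<sigma> b = enat (Suc i) \<and> \<tau> = exchange a b \<sigma>"
      using a b ab i(4) exchange_eq_compose[OF \<sigma> ab(1) a(2) ab(2) b(2)]
      by (intro exI[of _ a] exI[of _ b] exI[of _ i]) simp
  next
    assume "\<sigma> \<in> perms_at A \<and>
     (\<exists>a b i. 1 \<le> a \<and> a < b \<and> \<sigma> a = enat i \<and> \<sigma> b = enat (Suc i) \<and> \<tau> = exchange a b \<sigma>)"
    then obtain a b i where *: "1 \<le> a" "a < b" "\<sigma> a = enat i" "\<sigma> b = enat (Suc i)"
      "\<tau> = exchange a b \<sigma>" by blast
    then show "weak_cover A \<sigma> \<tau>"
      unfolding weak_cover_def
      using \<sigma> exchange_eq_compose[OF \<sigma>, of a i b "Suc i"] perms_at_symbol_range[OF \<sigma>, of a i]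
        perms_at_symbol_range[OF \<sigma>, of b "Suc i"] position_eq[OF \<sigma>, of a i]
        position_eq[OF \<sigma>, of b "Suc i"]
      by (intro conjI exI[of _ i]) auto
  qed
qed (simp add: weak_cover_def)

lemma weak_cover_perms_at:
  assumes "weak_cover A \<sigma> \<tau>"
  shows "\<sigma> \<in> perms_at A" "\<tau> \<in> perms_at A"
proof -
  show \<sigma>: "\<sigma> \<in> perms_at A" using assms by (simp add: weak_cover_def)
  obtain a b i where "1 \<le> a" "a < b" "\<sigma> a = enat i" "\<sigma> b = enat (Suc i)" "\<tau> = exchange a b \<sigma>"
    using assms by (auto simp: weak_cover_iff_exchange)
  then show "\<tau> \<in> perms_at A"
    using exchange_perms_at[OF \<sigma>, of a b] perms_at_concrete[OF \<sigma>] by auto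
qed

text \<open>
  The exchange of two consecutive symbols is monotone on all other symbols, and no other symbol
  lies between the two.
\<close>

lemma exchange_less_iff:
  assumes \<sigma>: "\<sigma> \<in> perms_at A" and a: "1 \<le> a" "\<sigma> a = enat i" and b: "1 \<le> b" "\<sigma> b = enat (Suc i)"
    and pq: "1 \<le> p" "1 \<le> q" "{p, q} \<noteq> {a, b}"
  shows "exchange a b \<sigma> p < exchange a b \<sigma> q \<longleftrightarrow> \<sigma> p < \<sigma> q"
proof -
  have third: "\<sigma> r < enat i \<longleftrightarrow> \<sigma> r < enat (Suc i)" "enat i < \<sigma> r \<longleftrightarrow> enat (Suc i) < \<sigma> r"
    if "1 \<le> r" "r \<noteq> a" "r \<noteq> b" for r
  proof -
    have "\<sigma> r \<noteq> enat i" "\<sigma> r \<noteq> enat (Suc i)"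
      using position_eq[OF \<sigma> that(1)] position_eq[OF \<sigma> a] position_eq[OF \<sigma> b] that by blast+
    then show "\<sigma> r < enat i \<longleftrightarrow> \<sigma> r < enat (Suc i)" "enat i < \<sigma> r \<longleftrightarrow> enat (Suc i) < \<sigma> r"
      by (cases "\<sigma> r"; auto)+
  qed
  have "a \<noteq> b" using a b by auto
  then show ?thesis
    using third[of p] third[of q] pq a b by (auto simp: exchange_def)
qed

text \<open>
  A cover reverses a single pair, and that pair was not an inversion before.
\<close>

lemma weak_le_inversion:
  assumes "weak_le A \<sigma> \<tau>" and pq: "p \<in> A" "q \<in> A" "p < q" and inv: "\<sigma> q < \<sigma> p"
  shows "\<tau> q < \<tau> p"
proof -
  have step: "\<tau> q < \<tau> p" if c: "weak_cover A \<sigma> \<tau>" and "\<sigma> q < \<sigma> p" for \<sigma> \<tau>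
  proof -
    obtain a b i where *: "\<sigma> \<in> perms_at A" "1 \<le> a" "a < b" "\<sigma> a = enat i" "\<sigma> b = enat (Suc i)"
      "\<tau> = exchange a b \<sigma>" using c by (auto simp: weak_cover_iff_exchange)
    have 1: "1 \<le> p" "1 \<le> q" using pq perms_at_concrete[OF *(1)] by blast+
    have "{q, p} \<noteq> {a, b}" using *(3-5) pq that(2) by (auto simp: doubleton_eq_iff)
    then show ?thesis
      using exchange_less_iff[OF *(1,2,4) _ *(5) 1(2,1)] * that(2) by simp
  qed
  have "(weak_cover A)\<^sup>*\<^sup>* \<sigma> \<tau>" using assms(1) by (simp add: weak_le_def)
  then show ?thesis
    by (induction rule: rtranclp_induct) (use inv step in auto)
qed

text \<open>
  Exchanging \<open>i\<close> with an \<open>i + 1\<close> to its right turns the adjacent letters \<open>x\<^sub>u x\<^sub>v\<close> of the word into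
  \<open>x\<^bsub>v+1\<^esub> x\<^sub>u\<close>, where always \<open>u \<le> v\<close>, and \<open>u < v\<close> holds exactly when a symbol larger than both stands
  between them. So the defining relation of Thompson's monoid admits precisely those weak order
  covers in which a larger symbol separates the two.
\<close>

lemma word_of_perm_exchange:
  assumes \<sigma>: "\<sigma> \<in> perms_at A"
    and ab: "1 \<le> a" "a < b" and a: "\<sigma> a = enat (Suc k)" and b: "\<sigma> b = enat (Suc (Suc k))"
  defines "w \<equiv> word_of_perm \<sigma>"
  shows "word_of_perm (exchange a b \<sigma>) = w[k := Suc (w ! Suc k), Suc k := w ! k]"
    and "w ! k < w ! Suc k \<longleftrightarrow> (\<exists>r. a < r \<and> r < b \<and> \<sigma> b < \<sigma> r)"
proof -
  define \<tau> where "\<tau> = exchange a b \<sigma>"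
  have b1: "1 \<le> b" using ab by simp
  have aA: "a \<in> A" and bA: "b \<in> A"
    using perms_at_symbol_range(1)[OF \<sigma> ab(1) a] perms_at_symbol_range(1)[OF \<sigma> b1 b] by auto
  have kA: "Suc k < card A" using perms_at_symbol_range(3)[OF \<sigma> b1 b] by simp
  have \<tau>: "\<tau> \<in> perms_at A" unfolding \<tau>_def by (rule exchange_perms_at[OF \<sigma> aA bA])
  have \<tau>a: "\<tau> a = enat (Suc (Suc k))" and \<tau>b: "\<tau> b = enat (Suc k)"
    using a b ab by (auto simp: \<tau>_def exchange_def)
  have \<tau>o: "\<tau> j = \<sigma> j" if "j \<noteq> a" "j \<noteq> b" for j using that by (simp add: \<tau>_def exchange_def)
  \<comment> \<open>only \<open>b\<close> carries a symbol above \<open>k + 1\<close> but not above \<open>k + 2\<close>; the two counts below thus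
    both reduce to symbols above \<open>k + 2\<close>, before \<open>a\<close> or before \<open>b\<close>\<close>
  have up: "enat (Suc k) < \<sigma> j \<longleftrightarrow> enat (Suc (Suc k)) < \<sigma> j" if "1 \<le> j" "j \<noteq> b" for j
  proof -
    have "\<sigma> j \<noteq> enat (Suc (Suc k))"
      using position_eq[OF \<sigma> that(1)] position_eq[OF \<sigma> b1 b] that by blast
    then show ?thesis by (cases "\<sigma> j") auto
  qed
  define P where "P = {j \<in> {1..<a}. enat (Suc (Suc k)) < \<sigma> j}"
  define Q where "Q = {j \<in> {1..<b}. enat (Suc (Suc k)) < \<sigma> j}"
  have wk: "w ! k = card P"
  proof -
    have "{j \<in> {1..<a}. enat (Suc k) < \<sigma> j} = P"
      unfolding P_def using up ab by auto
    then show ?thesis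
      using nth_word_of_perm[OF \<sigma>, of k] inv_count_eq[OF \<sigma> ab(1) a] kA by (simp add: w_def)
  qed
  have wSk: "w ! Suc k = card Q"
    using nth_word_of_perm[OF \<sigma>, of "Suc k"] inv_count_eq[OF \<sigma> b1 b] kA by (simp add: w_def Q_def)
  have tSk: "word_of_perm \<tau> ! Suc k = card P"
  proof -
    have "{j \<in> {1..<a}. enat (Suc (Suc k)) < \<tau> j} = P"
      unfolding P_def using \<tau>o ab by auto
    then show ?thesis
      using nth_word_of_perm[OF \<tau>, of "Suc k"] inv_count_eq[OF \<tau> ab(1) \<tau>a] kA by simp
  qed
  have tk: "word_of_perm \<tau> ! k = Suc (card Q)"
  proof -
    \<comment> \<open>after the exchange \<open>a\<close> carries the larger symbol and is counted in addition\<close>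
    have "{j \<in> {1..<b}. enat (Suc k) < \<tau> j} = insert a Q"
    proof (rule Set.set_eqI)
      fix j
      show "j \<in> {j \<in> {1..<b}. enat (Suc k) < \<tau> j} \<longleftrightarrow> j \<in> insert a Q"
        using \<tau>o[of j] up[of j] \<tau>a ab by (cases "j = a") (auto simp: Q_def)
    qed
    moreover have "a \<notin> Q" "finite Q" using a by (auto simp: Q_def)
    ultimately show ?thesis
      using nth_word_of_perm[OF \<tau>, of k] inv_count_eq[OF \<tau> b1 \<tau>b] kA by simp
  qed
  have other: "word_of_perm \<tau> ! l = w ! l" if l: "l < card A" "l \<noteq> k" "l \<noteq> Suc k" for l
  proof -
    obtain q where q: "q \<in> A" "\<sigma> q = enat (Suc l)"
      using perms_at_symbol[OF \<sigma>, of "Suc l"] l by auto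
    have q1: "1 \<le> q" using q perms_at_concrete[OF \<sigma>] by blast
    have qab: "q \<noteq> a" "q \<noteq> b" using q a b l by auto
    have \<tau>q: "\<tau> q = enat (Suc l)" using q \<tau>o[OF qab] by simp
    have "enat (Suc l) < \<tau> j \<longleftrightarrow> enat (Suc l) < \<sigma> j" if "1 \<le> j" for j
      using exchange_less_iff[OF \<sigma> ab(1) a b1 b q1 that] qab q(2) \<tau>q
      by (auto simp: \<tau>_def doubleton_eq_iff)
    then have "{j \<in> {1..<q}. enat (Suc l) < \<tau> j} = {j \<in> {1..<q}. enat (Suc l) < \<sigma> j}" by auto
    then show ?thesis
      using nth_word_of_perm[OF \<tau> l(1)] nth_word_of_perm[OF \<sigma> l(1)]
        inv_count_eq[OF \<tau> q1 \<tau>q] inv_count_eq[OF \<sigma> q1 q(2)] by (simp add: w_def)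
  qed
  have len: "length w = card A" "length (word_of_perm \<tau>) = card A"
    using length_word_of_perm[OF \<sigma>] length_word_of_perm[OF \<tau>] by (simp_all add: w_def)
  show "word_of_perm (exchange a b \<sigma>) = w[k := Suc (w ! Suc k), Suc k := w ! k]"
    unfolding \<tau>_def[symmetric]
  proof (rule nth_equalityI)
    fix l assume l: "l < length (word_of_perm \<tau>)"
    then show "word_of_perm \<tau> ! l = w[k := Suc (w ! Suc k), Suc k := w ! k] ! l"
      using tk tSk wk wSk other[of l] len kA
      by (cases "l = k"; cases "l = Suc k") auto
  qed (simp add: len)
  have PQ: "P \<subseteq> Q" and fQ: "finite Q" using ab by (auto simp: P_def Q_def)
  have "card P < card Q \<longleftrightarrow> P \<noteq> Q"
    using psubset_card_mono[OF fQ, of P] PQ by auto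
  also have "\<dots> \<longleftrightarrow> (\<exists>r. r \<in> Q \<and> r \<notin> P)" using PQ by blast
  also have "\<dots> \<longleftrightarrow> (\<exists>r. a < r \<and> r < b \<and> \<sigma> b < \<sigma> r)"
  proof -
    have "r \<in> Q \<and> r \<notin> P \<longleftrightarrow> a < r \<and> r < b \<and> \<sigma> b < \<sigma> r" for r
      using a b ab by (cases "r = a") (auto simp: P_def Q_def)
    then show ?thesis by simp
  qed
  finally show "w ! k < w ! Suc k \<longleftrightarrow> (\<exists>r. a < r \<and> r < b \<and> \<sigma> b < \<sigma> r)"
    using wk wSk by simp
qed

definition separated_cover :: "nat set \<Rightarrow> (nat \<Rightarrow> enat) \<Rightarrow> (nat \<Rightarrow> enat) \<Rightarrow> bool" where
  "separated_cover A \<sigma> \<tau> \<longleftrightarrow> \<sigma> \<in> perms_at A \<and>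
     (\<exists>a b r i. 1 \<le> a \<and> a < r \<and> r < b \<and> \<sigma> a = enat i \<and> \<sigma> b = enat (Suc i) \<and> \<sigma> b < \<sigma> r \<and>
        \<tau> = exchange a b \<sigma>)"

lemma separated_cover_imp_weak_cover: "separated_cover A \<sigma> \<tau> \<Longrightarrow> weak_cover A \<sigma> \<tau>"
  unfolding separated_cover_def weak_cover_iff_exchange using less_trans by blast

lemma separated_cover_imp_pres_equiv:
  assumes "separated_cover A \<sigma> \<tau>"
  shows "pres_equiv thompson_rels (word_of_perm \<sigma>) (word_of_perm \<tau>)"
proof -
  obtain a b r i where \<sigma>: "\<sigma> \<in> perms_at A" and *: "1 \<le> a" "a < r" "r < b" "\<sigma> a = enat i"
    "\<sigma> b = enat (Suc i)" "\<sigma> b < \<sigma> r" "\<tau> = exchange a b \<sigma>"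
    using assms by (auto simp: separated_cover_def)
  have "1 \<le> i" using perms_at_symbol_range[OF \<sigma> *(1,4)] by simp
  then obtain k where k: "i = Suc k" by (cases i) auto
  define w where "w = word_of_perm \<sigma>"
  have "1 \<le> b" using * by simp
  then have len: "Suc k < length w"
    using perms_at_symbol_range(3)[OF \<sigma> _ *(5)] length_word_of_perm[OF \<sigma>] k by (simp add: w_def)
  have ab: "a < b" using * by simp
  note ex = word_of_perm_exchange[OF \<sigma> *(1) ab *(4,5)[unfolded k], folded w_def]
  have less: "w ! k < w ! Suc k" using ex(2) * by blast
  define x u v y where "x = take k w" and "u = w ! k" and "v = w ! Suc k"
    and "y = drop (Suc (Suc k)) w"
  have w: "w = x @ [u, v] @ y"
    using len by (simp add: Cons_nth_drop_Suc x_def u_def v_def y_def)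
  have "length x = k" using len by (simp add: x_def)
  then have "(x @ [u, v] @ y)[k := Suc v, Suc k := u] = x @ [v + 1, u] @ y"
    by (simp add: list_update_append)
  then have w': "word_of_perm \<tau> = x @ [v + 1, u] @ y"
    unfolding *(7) ex(1) u_def[symmetric] v_def[symmetric] using w by simp
  have "pres_equiv thompson_rels [u, v] [v + 1, u]"
    by (rule pres_equiv.rel) (use less in \<open>auto simp: thompson_rels_def u_def v_def\<close>)
  then have "pres_equiv thompson_rels (x @ [u, v] @ y) (x @ [v + 1, u] @ y)"
    by (intro pres_equiv.append pres_equiv.refl)
  then show ?thesis unfolding w'[symmetric] w[symmetric] by (simp add: w_def)
qed

lemma thompson_rel_imp_separated_cover:
  assumes "i < j"
  obtains A where "separated_cover A (perm_of_word (x @ [i, j] @ y)) (perm_of_word (x @ [j + 1, i] @ y))"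
proof -
  define w where "w = x @ [i, j] @ y"
  define k where "k = length x"
  obtain A where \<sigma>: "perm_of_word w \<in> perms_at A" and word: "word_of_perm (perm_of_word w) = w"
    using perm_of_word .
  define \<sigma> where "\<sigma> = perm_of_word w"
  have \<sigma>: "\<sigma> \<in> perms_at A" and word: "word_of_perm \<sigma> = w"
    using \<sigma> word by (simp_all add: \<sigma>_def)
  have cA: "card A = length w" using length_word_of_perm[OF \<sigma>] word by simp
  have kA: "Suc k < card A" unfolding cA by (simp add: w_def k_def)
  have wk: "w ! k = i" "w ! Suc k = j" by (simp_all add: w_def k_def nth_append)
  obtain a where a: "a \<in> A" "\<sigma> a = enat (Suc k)"
    using perms_at_symbol[OF \<sigma>, of "Suc k"] kA by auto
  obtain b where b: "b \<in> A" "\<sigma> b = enat (Suc (Suc k))"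
    using perms_at_symbol[OF \<sigma>, of "Suc (Suc k)"] kA by auto
  have ab1: "1 \<le> a" "1 \<le> b" using a b perms_at_concrete[OF \<sigma>] by blast+
  have ab: "a < b"
  proof (rule ccontr)
    assume "\<not> a < b"
    \<comment> \<open>then everything counted for the larger symbol is counted for the smaller one too\<close>
    then have "card {p \<in> {1..<b}. enat (Suc (Suc k)) < \<sigma> p} \<le> card {p \<in> {1..<a}. enat (Suc k) < \<sigma> p}"
      by (intro card_mono) (auto intro: less_trans[of "enat (Suc k)" "enat (Suc (Suc k))"])
    then have "w ! Suc k \<le> w ! k"
      using inv_count_eq[OF \<sigma> ab1(1) a(2)] inv_count_eq[OF \<sigma> ab1(2) b(2)]
        nth_word_of_perm[OF \<sigma>] kA word by simp
    then show False using wk assms by simp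
  qed
  note ex = word_of_perm_exchange[OF \<sigma> ab1(1) ab a(2) b(2), unfolded word wk]
  obtain r where r: "a < r" "r < b" "\<sigma> b < \<sigma> r" using ex(2) assms by blast
  have "word_of_perm (exchange a b \<sigma>) = x @ [j + 1, i] @ y"
    unfolding ex(1) by (simp add: w_def k_def list_update_append)
  then have \<tau>: "perm_of_word (x @ [j + 1, i] @ y) = exchange a b \<sigma>"
    using perm_of_word_of_perm[OF exchange_perms_at[OF \<sigma> a(1) b(1)]] by simp
  have "separated_cover A \<sigma> (exchange a b \<sigma>)"
    unfolding separated_cover_def using \<sigma> ab1 r a b by blast
  then show ?thesis using that[of A] \<tau> by (simp add: \<sigma>_def w_def)
qed

section \<open>The domination relation\<close>

text \<open>
  These are the ancestor pairs of the Cartesian forest on the concrete positions: the root of an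
  interval of concrete positions is the position of its largest symbol, and stars separate the
  trees.
\<close>

definition dominates :: "(nat \<Rightarrow> enat) \<Rightarrow> nat \<Rightarrow> nat \<Rightarrow> bool" where
  "dominates \<sigma> q p \<longleftrightarrow> 1 \<le> p \<and> 1 \<le> q \<and> p \<noteq> q \<and> \<sigma> q \<noteq> \<infinity> \<and>
     (\<forall>r\<in>{min p q..max p q}. r \<noteq> q \<longrightarrow> \<sigma> r < \<sigma> q)"

lemma dominates_less: "dominates \<sigma> q p \<Longrightarrow> \<sigma> p < \<sigma> q"
  by (auto simp: dominates_def)

lemma dominates_between:
  "dominates \<sigma> q p \<Longrightarrow> r \<in> {min p q..max p q} \<Longrightarrow> r \<noteq> q \<Longrightarrow> dominates \<sigma> q r"
  unfolding dominates_def by (auto simp: min_def max_def split: if_splits)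

lemma dominates_perms_at:
  assumes "\<sigma> \<in> perms_at A" "dominates \<sigma> q p"
  shows "q \<in> A" "p \<in> A"
proof -
  have "\<sigma> p \<noteq> \<infinity>" using dominates_less[OF assms(2)] by (cases "\<sigma> p") auto
  then show "q \<in> A" "p \<in> A"
    using assms(2) perms_at_concrete[OF assms(1)] by (simp_all add: dominates_def)
qed

text \<open>
  A comparison with the dominating position \<open>q\<close> is affected only if it is the comparison between the
  two exchanged positions. Then the larger symbol between these positions lies between \<open>p\<close> and
  \<open>q\<close>, and it prevents \<open>q\<close> from dominating \<open>p\<close>, before the exchange and after it.
\<close>

lemma dominates_separated_cover:
  assumes "separated_cover A \<sigma> \<tau>"
  shows "dominates \<tau> = dominates \<sigma>"
proof -
  obtain a b r i where \<sigma>: "\<sigma> \<in> perms_at A" and *: "1 \<le> a" "a < r" "r < b" "\<sigma> a = enat i"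
    "\<sigma> b = enat (Suc i)" "\<sigma> b < \<sigma> r" "\<tau> = exchange a b \<sigma>"
    using assms by (auto simp: separated_cover_def)
  have b1: "1 \<le> b" using * by simp
  have inf: "\<tau> q \<noteq> \<infinity> \<longleftrightarrow> \<sigma> q \<noteq> \<infinity>" for q
    using * by (auto simp: exchange_def)
  have less: "\<tau> s < \<tau> q \<longleftrightarrow> \<sigma> s < \<sigma> q" if "1 \<le> s" "1 \<le> q" "{s, q} \<noteq> {a, b}" for s q
    unfolding *(7) by (rule exchange_less_iff[OF \<sigma> *(1,4) b1 *(5) that])
  have big: "\<not> \<sigma> r < \<sigma> q" "\<not> \<tau> r < \<tau> q" if "q \<in> {a, b}" for q
    using that * by (auto simp: exchange_def not_less intro: order.trans[of _ "enat (Suc i)"] order_less_imp_le)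
  have "dominates \<tau> q p \<longleftrightarrow> dominates \<sigma> q p" for q p
  proof (cases "q \<in> {a, b} \<and> r \<in> {min p q..max p q}")
    case True
    then have "\<not> dominates \<sigma> q p" "\<not> dominates \<tau> q p"
      using big[of q] * unfolding dominates_def by auto
    then show ?thesis by simp
  next
    case False
    have "\<tau> s < \<tau> q \<longleftrightarrow> \<sigma> s < \<sigma> q"
      if "s \<in> {min p q..max p q}" "1 \<le> p" "1 \<le> q" for s
    proof (rule less)
      show "1 \<le> s" "1 \<le> q" using that by auto
      show "{s, q} \<noteq> {a, b}"
        using that False *(2,3) by (auto simp: doubleton_eq_iff)
    qed
    then show ?thesis unfolding dominates_def using inf by blast
  qed
  then show ?thesis by (intro ext)
qed

text \<open>
  If \<open>q\<close> dominates \<open>p\<close> in \<open>\<rho>\<close>, then all positions from \<open>p\<close> to \<open>q\<close> are concrete, and in \<open>\<sigma>\<close> the one with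
  the largest symbol dominates the others. By the inclusion it does so in \<open>\<rho>\<close>, so it is \<open>q\<close>.
\<close>

lemma dominates_eqI:
  assumes \<sigma>: "\<sigma> \<in> perms_at A" and \<rho>: "\<rho> \<in> perms_at A"
    and sub: "\<And>q p. dominates \<sigma> q p \<Longrightarrow> dominates \<rho> q p"
  shows "dominates \<rho> = dominates \<sigma>"
proof -
  have "dominates \<sigma> q p" if d: "dominates \<rho> q p" for q p
  proof -
    define I where "I = {min p q..max p q}"
    have pq: "1 \<le> p" "1 \<le> q" "p \<noteq> q" using d by (auto simp: dominates_def)
    have IA: "I \<subseteq> A"
      using dominates_perms_at[OF \<rho> d] dominates_perms_at(2)[OF \<rho> dominates_between[OF d]]
      unfolding I_def by blast
    have "finite I" "I \<noteq> {}" by (auto simp: I_def)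
    then obtain t where t: "t \<in> I" "\<forall>s\<in>I. \<sigma> s \<le> \<sigma> t"
      using obtains_MAX[of I \<sigma>] by (metis Max_ge finite_imageI imageI)
    have max: "\<sigma> s < \<sigma> t" if "s \<in> I" "s \<noteq> t" for s
      using t that perms_at_inj[OF \<sigma>, of s t] IA by (auto simp: order_le_less)
    have tq: "t = q"
    proof (rule ccontr)
      assume tq: "t \<noteq> q"
      have "{min q t..max q t} \<subseteq> I" using t(1) by (auto simp: I_def)
      then have "dominates \<sigma> t q"
        using max t(1) tq pq IA perms_at_concrete[OF \<sigma>, of t] unfolding dominates_def by auto
      then have "\<rho> q < \<rho> t" by (intro dominates_less sub)
      moreover have "\<rho> t < \<rho> q"
        using d t(1) tq by (auto simp: dominates_def I_def)
      ultimately show False by simp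
    qed
    then have "q \<in> A" using t(1) IA by blast
    then show ?thesis
      using max tq pq perms_at_concrete[OF \<sigma>, of q] unfolding dominates_def I_def by auto
  qed
  then show ?thesis using sub by blast
qed

text \<open>
  If \<open>q\<close> dominates the position \<open>s\<close>, then the pair is an inversion of the bottom \<open>\<beta>\<close> when \<open>q < s\<close>, and a
  noninversion of the top \<open>\<tau>\<close> when \<open>s < q\<close>. Everything in between inherits the inversions of
  \<open>\<beta>\<close> and the noninversions of \<open>\<tau>\<close>.
\<close>

lemma dominates_weak_interval:
  assumes le: "weak_le A \<beta> \<rho>" "weak_le A \<rho> \<tau>" and eq: "dominates \<beta> = dominates \<tau>"
  shows "dominates \<rho> = dominates \<beta>"
proof (rule dominates_eqI)
  show \<beta>: "\<beta> \<in> perms_at A" and \<rho>: "\<rho> \<in> perms_at A" using le by (auto simp: weak_le_def)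
  have \<tau>: "\<tau> \<in> perms_at A" using le by (auto simp: weak_le_def)
  fix q p assume d: "dominates \<beta> q p"
  have less: "\<rho> s < \<rho> q" if s: "s \<in> {min p q..max p q}" "s \<noteq> q" for s
  proof -
    have ds: "dominates \<beta> q s" "dominates \<tau> q s"
      using dominates_between[OF d s] eq by auto
    have A: "q \<in> A" "s \<in> A" using dominates_perms_at[OF \<beta> ds(1)] by auto
    show ?thesis
    proof (cases "q < s")
      case True
      then show ?thesis
        using weak_le_inversion[OF le(1) A] dominates_less[OF ds(1)] by simp
    next
      case False
      then have "s < q" using s by simp
      then show ?thesis
        using weak_le_inversion[OF le(2) A(2,1)] dominates_less[OF ds(2)] perms_at_inj[OF \<rho> A] s(2)
        by (metis linorder_neqE not_less_iff_gr_or_eq)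
    qed
  qed
  show "dominates \<rho> q p"
    using less d dominates_perms_at[OF \<beta> d] perms_at_concrete[OF \<rho>, of q]
    unfolding dominates_def by auto
qed


section \<open>Pattern avoidance\<close>

text \<open>
  If the outer symbols \<open>v = \<sigma> a\<close> and \<open>u = \<sigma> c\<close> of a \<open>231\<close> pattern are not consecutive, the symbol \<open>u + 1\<close>
  yields a pattern with closer outer symbols: it replaces \<open>v\<close> when it stands left of the middle
  position, and \<open>u\<close> when it stands right of it. Consecutive outer symbols can be exchanged.
\<close>

lemma pattern_231_separated:
  assumes \<sigma>: "\<sigma> \<in> perms_at A" and "1 \<le> a" "a < b" "b < c" "\<sigma> c < \<sigma> a" "\<sigma> a < \<sigma> b"
  shows "\<exists>\<rho>. separated_cover A \<rho> \<sigma>"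
proof -
  obtain u v where "\<sigma> c = enat u" "\<sigma> a = enat v"
    using \<open>\<sigma> c < \<sigma> a\<close> \<open>\<sigma> a < \<sigma> b\<close> by (cases "\<sigma> c"; cases "\<sigma> a"; simp)
  then show ?thesis using assms(2-)
  proof (induction "v - u" arbitrary: a c u v rule: less_induct)
    case less
    have uv: "u < v" using less.prems by simp
    have c1: "1 \<le> c" using less.prems by auto
    have aA: "a \<in> A" "v \<le> card A" and cA: "c \<in> A" "1 \<le> u"
      using perms_at_symbol_range[OF \<sigma> less.prems(3,2)] perms_at_symbol_range[OF \<sigma> c1 less.prems(1)]
      by auto
    show ?case
    proof (cases "v = Suc u")
      case True
      have "exchange a c (exchange a c \<sigma>) = \<sigma>" by (auto simp: exchange_def)
      moreover have "exchange a c \<sigma> \<in> perms_at A" by (rule exchange_perms_at[OF \<sigma> aA(1) cA(1)])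
      ultimately have "separated_cover A (exchange a c \<sigma>) \<sigma>"
        using less.prems True unfolding separated_cover_def
        by (intro conjI exI[of _ a] exI[of _ c] exI[of _ b] exI[of _ u]) (auto simp: exchange_def)
      then show ?thesis by blast
    next
      case False
      obtain s where s: "s \<in> A" "\<sigma> s = enat (Suc u)"
        using perms_at_symbol[OF \<sigma>, of "Suc u"] uv aA(2) by auto
      have s1: "1 \<le> s" using s perms_at_concrete[OF \<sigma>] by blast
      have sb: "\<sigma> s < \<sigma> b"
        using uv s less.prems(2,7) order.strict_trans1[of "\<sigma> s" "\<sigma> a" "\<sigma> b"] by simp
      then consider "s < b" | "b < s" by (metis less_irrefl linorder_neqE_nat)
      then show ?thesis
      proof cases
        case 1
        show ?thesis
          by (rule less.hyps[of "Suc u" u c s]) (use 1 uv False s s1 sb less.prems in auto)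
      next
        case 2
        show ?thesis
          by (rule less.hyps[of v "Suc u" s a]) (use 2 uv False s s1 sb less.prems in auto)
      qed
    qed
  qed
qed

text \<open>
  The mirror image: \<open>u + 1\<close> replaces \<open>u = \<sigma> a\<close> or \<open>v = \<sigma> c\<close>, depending on the side on which it stands.
\<close>

lemma pattern_132_separated:
  assumes \<sigma>: "\<sigma> \<in> perms_at A" and "1 \<le> a" "a < b" "b < c" "\<sigma> a < \<sigma> c" "\<sigma> c < \<sigma> b"
  shows "\<exists>\<rho>. separated_cover A \<sigma> \<rho>"
proof -
  obtain u v where "\<sigma> a = enat u" "\<sigma> c = enat v"
    using \<open>\<sigma> a < \<sigma> c\<close> \<open>\<sigma> c < \<sigma> b\<close> by (cases "\<sigma> a"; cases "\<sigma> c"; simp)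
  then show ?thesis using assms(2-)
  proof (induction "v - u" arbitrary: a c u v rule: less_induct)
    case less
    have uv: "u < v" using less.prems by simp
    have c1: "1 \<le> c" using less.prems by auto
    have cA: "v \<le> card A"
      using perms_at_symbol_range[OF \<sigma> c1 less.prems(2)] by auto
    show ?case
    proof (cases "v = Suc u")
      case True
      then show ?thesis
        using less.prems \<sigma> unfolding separated_cover_def by blast
    next
      case False
      obtain s where s: "s \<in> A" "\<sigma> s = enat (Suc u)"
        using perms_at_symbol[OF \<sigma>, of "Suc u"] uv cA by auto
      have s1: "1 \<le> s" using s perms_at_concrete[OF \<sigma>] by blast
      have sb: "\<sigma> s < \<sigma> b"
        using uv s less.prems(2,7) order.strict_trans1[of "\<sigma> s" "\<sigma> c" "\<sigma> b"] by simp
      then consider "s < b" | "b < s" by (metis less_irrefl linorder_neqE_nat)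
      then show ?thesis
      proof cases
        case 1
        show ?thesis
          by (rule less.hyps[of v "Suc u" s c]) (use 1 uv False s s1 sb less.prems in auto)
      next
        case 2
        show ?thesis
          by (rule less.hyps[of "Suc u" u a s]) (use 2 uv False s s1 sb less.prems in auto)
      qed
    qed
  qed
qed

text \<open>
  An inversion whose left position does not dominate the right one has a larger symbol in
  between, hence is part of a \<open>231\<close> pattern, which admits a step down.
\<close>

lemma minimal_inversion_iff:
  assumes \<sigma>: "\<sigma> \<in> perms_at A" and min: "\<And>\<rho>. \<not> separated_cover A \<rho> \<sigma>"
    and pq: "p \<in> A" "q \<in> A" "p < q"
  shows "\<sigma> q < \<sigma> p \<longleftrightarrow> dominates \<sigma> p q"
proof
  assume inv: "\<sigma> q < \<sigma> p"
  have p1: "1 \<le> p" "\<sigma> p \<noteq> \<infinity>" using pq perms_at_concrete[OF \<sigma>] by blast+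
  have "\<sigma> r < \<sigma> p" if r: "p < r" "r \<le> q" for r
  proof (rule ccontr)
    assume n: "\<not> \<sigma> r < \<sigma> p"
    have "\<sigma> r \<noteq> \<sigma> p"
      using position_eq[OF \<sigma>, of r] position_eq[OF \<sigma>, of p] p1 r by (cases "\<sigma> p") fastforce+
    then have pr: "\<sigma> p < \<sigma> r" using n by simp
    then have "r < q" using r inv by (cases "r = q") auto
    then show False
      using pattern_231_separated[OF \<sigma> p1(1) r(1) _ inv pr] min by blast
  qed
  then show "dominates \<sigma> p q"
    using p1 pq by (auto simp: dominates_def)
qed (rule dominates_less)

lemma maximal_noninversion_iff:
  assumes \<sigma>: "\<sigma> \<in> perms_at A" and max: "\<And>\<rho>. \<not> separated_cover A \<sigma> \<rho>"
    and pq: "p \<in> A" "q \<in> A" "p < q"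
  shows "\<sigma> p < \<sigma> q \<longleftrightarrow> dominates \<sigma> q p"
proof
  assume ninv: "\<sigma> p < \<sigma> q"
  have q1: "1 \<le> q" "\<sigma> q \<noteq> \<infinity>" and p1: "1 \<le> p" using pq perms_at_concrete[OF \<sigma>] by blast+
  have "\<sigma> r < \<sigma> q" if r: "p \<le> r" "r < q" for r
  proof (rule ccontr)
    assume n: "\<not> \<sigma> r < \<sigma> q"
    have "\<sigma> r \<noteq> \<sigma> q"
      using position_eq[OF \<sigma>, of r] position_eq[OF \<sigma>, of q] q1 p1 r by (cases "\<sigma> q") fastforce+
    then have qr: "\<sigma> q < \<sigma> r" using n by simp
    then have "p < r" using r ninv by (cases "r = p") auto
    then show False
      using pattern_132_separated[OF \<sigma> p1 _ r(2) ninv qr] max by blast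
  qed
  then show "dominates \<sigma> q p"
    using p1 q1 pq by (auto simp: dominates_def)
qed (rule dominates_less)


section \<open>Bottom and top of a class\<close>

text \<open>
  The number of inversions is the measure that makes the descent and the ascent along
  separated covers terminate.
\<close>

definition inversions :: "nat set \<Rightarrow> (nat \<Rightarrow> enat) \<Rightarrow> (nat \<times> nat) set" where
  "inversions A \<sigma> = {(p, q) \<in> A \<times> A. p < q \<and> \<sigma> q < \<sigma> p}"

lemma weak_cover_inversions:
  assumes "weak_cover A \<sigma> \<tau>"
  shows "inversions A \<sigma> \<subset> inversions A \<tau>"
proof
  have "weak_le A \<sigma> \<tau>" using assms weak_cover_perms_at[OF assms] by (auto simp: weak_le_def)
  then show "inversions A \<sigma> \<subseteq> inversions A \<tau>"
    using weak_le_inversion by (auto simp: inversions_def)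
  obtain a b i where *: "\<sigma> \<in> perms_at A" "1 \<le> a" "a < b" "\<sigma> a = enat i" "\<sigma> b = enat (Suc i)"
      "\<tau> = exchange a b \<sigma>" using assms by (auto simp: weak_cover_iff_exchange)
  then have "(a, b) \<in> inversions A \<tau>" "(a, b) \<notin> inversions A \<sigma>"
    using perms_at_concrete[OF *(1)] by (auto simp: inversions_def exchange_def)
  then show "inversions A \<sigma> \<noteq> inversions A \<tau>" by blast
qed

lemma inversions_subset: "inversions A \<sigma> \<subseteq> A \<times> A"
  by (auto simp: inversions_def)

lemma ex_minimal_below:
  assumes "\<sigma> \<in> perms_at A"
  shows "\<exists>\<beta>. (separated_cover A)\<^sup>*\<^sup>* \<beta> \<sigma> \<and> (\<forall>\<rho>. \<not> separated_cover A \<rho> \<beta>)"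
proof -
  have fin: "finite (A \<times> A)" using perms_at_finite[OF assms] by simp
  show ?thesis
  proof (induction "card (inversions A \<sigma>)" arbitrary: \<sigma> rule: less_induct)
    case less
    show ?case
    proof (cases "\<exists>\<rho>. separated_cover A \<rho> \<sigma>")
      case True
      then obtain \<rho> where \<rho>: "separated_cover A \<rho> \<sigma>" by blast
      have "card (inversions A \<rho>) < card (inversions A \<sigma>)"
        by (intro psubset_card_mono finite_subset[OF inversions_subset fin]
            weak_cover_inversions separated_cover_imp_weak_cover \<rho>)
      then show ?thesis using less.hyps \<rho> by (meson rtranclp.rtrancl_into_rtrancl)
    qed blast
  qed
qed

lemma ex_maximal_above:
  assumes "\<sigma> \<in> perms_at A"
  shows "\<exists>\<tau>. (separated_cover A)\<^sup>*\<^sup>* \<sigma> \<tau> \<and> (\<forall>\<rho>. \<not> separated_cover A \<tau> \<rho>)"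
proof -
  have fin: "finite (A \<times> A)" using perms_at_finite[OF assms] by simp
  show ?thesis
  proof (induction "card (A \<times> A - inversions A \<sigma>)" arbitrary: \<sigma> rule: less_induct)
    case less
    show ?case
    proof (cases "\<exists>\<rho>. separated_cover A \<sigma> \<rho>")
      case True
      then obtain \<rho> where \<rho>: "separated_cover A \<sigma> \<rho>" by blast
      have "inversions A \<sigma> \<subset> inversions A \<rho>"
        by (intro weak_cover_inversions separated_cover_imp_weak_cover \<rho>)
      then have "card (A \<times> A - inversions A \<rho>) < card (A \<times> A - inversions A \<sigma>)"
        using fin inversions_subset[of A \<rho>] by (intro psubset_card_mono) auto
      then show ?thesis using less.hyps \<rho> by (meson converse_rtranclp_into_rtranclp)
    qed blast
  qed
qed

lemma separated_covers:
  assumes "(separated_cover A)\<^sup>*\<^sup>* \<sigma> \<tau>"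
  shows "dominates \<sigma> = dominates \<tau>"
    and "pres_equiv thompson_rels (word_of_perm \<sigma>) (word_of_perm \<tau>)"
    and "\<sigma> \<in> perms_at A \<longleftrightarrow> \<tau> \<in> perms_at A"
    and "\<sigma> \<in> perms_at A \<Longrightarrow> weak_le A \<sigma> \<tau>"
proof -
  have "dominates \<sigma> = dominates \<tau> \<and> pres_equiv thompson_rels (word_of_perm \<sigma>) (word_of_perm \<tau>) \<and>
    (\<sigma> \<in> perms_at A \<longleftrightarrow> \<tau> \<in> perms_at A) \<and> (weak_cover A)\<^sup>*\<^sup>* \<sigma> \<tau>"
    using assms
  proof (induction rule: rtranclp_induct)
    case base
    show ?case by (simp add: pres_equiv.refl)
  next
    case (step \<rho> \<tau>)
    have "weak_cover A \<rho> \<tau>" by (rule separated_cover_imp_weak_cover[OF step(2)])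
    then show ?case
      using step.IH dominates_separated_cover[OF step(2)] separated_cover_imp_pres_equiv[OF step(2)]
        weak_cover_perms_at by (metis pres_equiv.trans rtranclp.rtrancl_into_rtrancl)
  qed
  then show "dominates \<sigma> = dominates \<tau>"
    "pres_equiv thompson_rels (word_of_perm \<sigma>) (word_of_perm \<tau>)"
    "\<sigma> \<in> perms_at A \<longleftrightarrow> \<tau> \<in> perms_at A"
    "\<sigma> \<in> perms_at A \<Longrightarrow> weak_le A \<sigma> \<tau>"
    by (auto simp: weak_le_def)
qed

lemma minimal_unique:
  assumes \<sigma>: "\<sigma> \<in> perms_at A" "\<And>\<rho>. \<not> separated_cover A \<rho> \<sigma>"
    and \<tau>: "\<tau> \<in> perms_at A" "\<And>\<rho>. \<not> separated_cover A \<rho> \<tau>"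
    and "dominates \<sigma> = dominates \<tau>"
  shows "\<sigma> = \<tau>"
proof (rule perms_at_eq_if_same_order[OF \<sigma>(1) \<tau>(1)])
  fix p q assume pq: "p \<in> A" "q \<in> A" "p < q"
  have "\<sigma> q < \<sigma> p \<longleftrightarrow> \<tau> q < \<tau> p"
    using minimal_inversion_iff[OF \<sigma> pq] minimal_inversion_iff[OF \<tau> pq] assms(5) by simp
  then show "\<sigma> p < \<sigma> q \<longleftrightarrow> \<tau> p < \<tau> q"
    using perms_at_inj[OF \<sigma>(1) pq(1,2)] perms_at_inj[OF \<tau>(1) pq(1,2)] pq(3)
    by (metis linorder_neqE not_less_iff_gr_or_eq)
qed

lemma maximal_unique:
  assumes \<sigma>: "\<sigma> \<in> perms_at A" "\<And>\<rho>. \<not> separated_cover A \<sigma> \<rho>"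
    and \<tau>: "\<tau> \<in> perms_at A" "\<And>\<rho>. \<not> separated_cover A \<tau> \<rho>"
    and "dominates \<sigma> = dominates \<tau>"
  shows "\<sigma> = \<tau>"
  using maximal_noninversion_iff[OF \<sigma>] maximal_noninversion_iff[OF \<tau>] assms(5)
  by (intro perms_at_eq_if_same_order[OF \<sigma>(1) \<tau>(1)]) simp

section \<open>Equivalent words\<close>

text \<open>
  A congruence is generated by replacing one side of a relation by the other inside an arbitrary
  context, so an invariant only has to be checked for single replacements.
\<close>

lemma pres_equiv_invariant:
  assumes "pres_equiv R u v"
    and "\<And>u v x y. (u, v) \<in> R \<Longrightarrow> f (x @ u @ y) = f (x @ v @ y)"
  shows "f u = f v"
proof -
  have "\<forall>x y. f (x @ u @ y) = f (x @ v @ y)"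
    using assms(1)
  proof induction
    case (append u v u' v')
    have "f (x @ (u @ u') @ y) = f (x @ (v @ v') @ y)" for x y
      using append.IH(1)[rule_format, of x "u' @ y"] append.IH(2)[rule_format, of "x @ v" y] by simp
    then show ?case by blast
  qed (use assms(2) in auto)
  from this[rule_format, of "[]" "[]"] show ?thesis by simp
qed

lemma pres_equiv_imp_same_dominates:
  assumes "pres_equiv thompson_rels u v"
  shows "concrete_positions (perm_of_word u) = concrete_positions (perm_of_word v)"
    and "dominates (perm_of_word u) = dominates (perm_of_word v)"
proof -
  let ?f = "\<lambda>w. (concrete_positions (perm_of_word w), dominates (perm_of_word w))"
  have "?f u = ?f v"
  proof (rule pres_equiv_invariant[OF assms])
    fix u v x y :: "nat list" assume "(u, v) \<in> thompson_rels"
    then obtain i j where ij: "i < j" "u = [i, j]" "v = [j + 1, i]" by (auto simp: thompson_rels_def)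
    obtain A where c: "separated_cover A (perm_of_word (x @ u @ y)) (perm_of_word (x @ v @ y))"
      using thompson_rel_imp_separated_cover[OF ij(1)] unfolding ij(2,3) .
    show "?f (x @ u @ y) = ?f (x @ v @ y)"
      using dominates_separated_cover[OF c] weak_cover_perms_at[OF separated_cover_imp_weak_cover[OF c]]
      by (simp add: perms_at_iff)
  qed
  then show "concrete_positions (perm_of_word u) = concrete_positions (perm_of_word v)"
    and "dominates (perm_of_word u) = dominates (perm_of_word v)" by simp_all
qed

theorem corollary3:
  fixes g :: "nat list set" and C :: "nat list set"
  assumes "g \<in> carrier P2"
    and "C = {w. word_value thompson_rels w = g}"
  shows "\<exists>A bottom top. finite A \<and> A \<subseteq> {1..} \<and>
           bottom \<in> perms_at A \<and> top \<in> perms_at A \<and> weak_le A bottom top \<and>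
           perm_of_word ` C = weak_interval A bottom top \<and>
           avoids_132 top \<and> avoids_231 bottom"
proof -
  obtain w where "g = word_value thompson_rels w"
    using assms(1) by (auto simp: P2_def carrier_presented_monoid)
  then have C: "C = {v. pres_equiv thompson_rels v w}"
    using assms(2) by (simp add: word_value_eq_iff)
  define \<sigma> where "\<sigma> = perm_of_word w"
  obtain A where \<sigma>: "\<sigma> \<in> perms_at A" and word\<sigma>: "word_of_perm \<sigma> = w"
    using perm_of_word[of w] unfolding \<sigma>_def .
  obtain \<beta> where \<beta>\<sigma>: "(separated_cover A)\<^sup>*\<^sup>* \<beta> \<sigma>" and min: "\<And>\<rho>. \<not> separated_cover A \<rho> \<beta>"
    using ex_minimal_below[OF \<sigma>] by blast
  obtain \<tau> where \<sigma>\<tau>: "(separated_cover A)\<^sup>*\<^sup>* \<sigma> \<tau>" and max: "\<And>\<rho>. \<not> separated_cover A \<tau> \<rho>"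
    using ex_maximal_above[OF \<sigma>] by blast
  have \<beta>: "\<beta> \<in> perms_at A" and \<tau>: "\<tau> \<in> perms_at A"
    using separated_covers(3)[OF \<beta>\<sigma>] separated_covers(3)[OF \<sigma>\<tau>] \<sigma> by auto
  have dom: "dominates \<beta> = dominates \<sigma>" "dominates \<tau> = dominates \<sigma>"
    using separated_covers(1)[OF \<beta>\<sigma>] separated_covers(1)[OF \<sigma>\<tau>] by auto
  have below: "(separated_cover A)\<^sup>*\<^sup>* \<beta> \<rho>" and above: "(separated_cover A)\<^sup>*\<^sup>* \<rho> \<tau>"
    if \<rho>: "\<rho> \<in> perms_at A" "dominates \<rho> = dominates \<sigma>" for \<rho>
  proof -
    obtain \<beta>' where b: "(separated_cover A)\<^sup>*\<^sup>* \<beta>' \<rho>" "\<And>\<rho>'. \<not> separated_cover A \<rho>' \<beta>'"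
      using ex_minimal_below[OF \<rho>(1)] by blast
    have "\<beta>' = \<beta>"
      by (rule minimal_unique[OF _ b(2) \<beta> min])
        (use separated_covers(1,3)[OF b(1)] \<rho> dom in auto)
    then show "(separated_cover A)\<^sup>*\<^sup>* \<beta> \<rho>" using b by simp
    obtain \<tau>' where t: "(separated_cover A)\<^sup>*\<^sup>* \<rho> \<tau>'" "\<And>\<rho>'. \<not> separated_cover A \<tau>' \<rho>'"
      using ex_maximal_above[OF \<rho>(1)] by blast
    have "\<tau>' = \<tau>"
      by (rule maximal_unique[OF _ t(2) \<tau> max])
        (use separated_covers(1,3)[OF t(1)] \<rho> dom in auto)
    then show "(separated_cover A)\<^sup>*\<^sup>* \<rho> \<tau>" using t by simp
  qed
  have "perm_of_word ` C = weak_interval A \<beta> \<tau>"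
  proof (intro equalityI subsetI)
    fix \<rho> assume "\<rho> \<in> perm_of_word ` C"
    then obtain v where v: "\<rho> = perm_of_word v" "pres_equiv thompson_rels v w" unfolding C by blast
    obtain B where "\<rho> \<in> perms_at B" using perm_of_word[of v] v(1) by metis
    moreover have "B = A"
      using pres_equiv_imp_same_dominates(1)[OF v(2)] \<sigma> \<open>\<rho> \<in> perms_at B\<close> v(1)
      by (simp add: perms_at_iff \<sigma>_def)
    ultimately have \<rho>: "\<rho> \<in> perms_at A" by simp
    have "dominates \<rho> = dominates \<sigma>"
      using pres_equiv_imp_same_dominates(2)[OF v(2)] v(1) by (simp add: \<sigma>_def)
    then show "\<rho> \<in> weak_interval A \<beta> \<tau>"
      using separated_covers(4)[OF below[OF \<rho>] \<beta>] separated_covers(4)[OF above[OF \<rho>] \<rho>] \<rho>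
      by (simp add: weak_interval_def)
  next
    fix \<rho> assume \<rho>: "\<rho> \<in> weak_interval A \<beta> \<tau>"
    then have \<rho>A: "\<rho> \<in> perms_at A" and "weak_le A \<beta> \<rho>" "weak_le A \<rho> \<tau>"
      by (auto simp: weak_interval_def)
    then have "dominates \<rho> = dominates \<sigma>"
      using dominates_weak_interval[of A \<beta> \<rho> \<tau>] dom by simp
    then have "pres_equiv thompson_rels (word_of_perm \<beta>) (word_of_perm \<rho>)"
      using separated_covers(2)[OF below[OF \<rho>A]] by simp
    moreover have "pres_equiv thompson_rels (word_of_perm \<beta>) w"
      using separated_covers(2)[OF \<beta>\<sigma>] word\<sigma> by simp
    ultimately have "word_of_perm \<rho> \<in> C"
      unfolding C using pres_equiv.sym pres_equiv.trans by blast
    then show "\<rho> \<in> perm_of_word ` C"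
      using perm_of_word_of_perm[OF \<rho>A] by (metis imageI)
  qed
  moreover have "weak_le A \<beta> \<tau>"
    using separated_covers(4)[OF below[OF \<tau> dom(2)] \<beta>] .
  moreover have "avoids_231 \<beta>"
    unfolding avoids_231_def using pattern_231_separated[OF \<beta>] min by blast
  moreover have "avoids_132 \<tau>"
    unfolding avoids_132_def using pattern_132_separated[OF \<tau>] max by blast
  moreover have "A \<subseteq> {1..}" using perms_at_concrete[OF \<sigma>] by auto
  ultimately show ?thesis
    using perms_at_finite[OF \<sigma>] \<beta> \<tau> by blast
qed

end
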